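(* Let $\mathcal{A}\in\mathbb{C}^{n\times n\times p}$ be a complex tensor and let $f(z)=\sum_{k=0}^{\infty}a_kz^k$ be a complex power series with convergence radius $\rho$. Let $\lambda^{(i)}_j$ ($i=1,\dots,p$, $j=1,\dots,n$) be the T-eigenvalues of $\mathcal{A}$ and let $\lambda_0=\max\{|\lambda^{(i)}_j| : i=1,\dots,p,\ j=1,\dots,n\}$. If $\rho>\lambda_0$, then the tensor power series $\sum_{k=0}^{\infty}a_k\mathcal{A}^k$ converges, and the T-eigenvalues of $\sum_{k=0}^{\infty}a_k\mathcal{A}^k$ are $$\sum_{k=0}^{\infty}a_k(\lambda^{(i)}_j)^k,\qquad i=1,\dots,p,\ j=1,\dots,n.$$
   Context: For $\mathcal{A}\in\mathbb{C}^{m\times n\times p}$ let $A^{(1)},\dots,A^{(p)}\in\mathbb{C}^{m\times n}$ be its frontal slices. $\mathrm{bcirc}(\mathcal{A})$ is the $mp\times np$ block circulant matrix whose $(i,j)$ block ($1\le i,j\le p$) is $A^{(((i-j)\bmod p)+1)}$; $\mathrm{unfold}(\mathcal{A})$ is the $mp\times n$ matrix obtained by stacking $A^{(1)},\dots,A^{(p)}$ vertically, and $\mathrm{fold}$ is the inverse of $\mathrm{unfold}$. The T-product of $\mathcal{A}\in\mathbb{C}^{m\times n\times p}$ and $\mathcal{B}\in\mathbb{C}^{n\times s\times p}$ is $\mathcal{A}*\mathcal{B}=\mathrm{fold}(\mathrm{bcirc}(\mathcal{A})\,\mathrm{unfold}(\mathcal{B}))$. Powers $\mathcal{A}^k$ are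 with respect to $*$, with $\mathcal{A}^0=\mathcal{I}$, the identity tensor (first frontal slice $I_n$, other slices zero). Let $F_p$ be the unitary $p\times p$ discrete Fourier matrix with entries $\frac{1}{\sqrt p}\omega^{(j-1)(k-1)}$, $\omega=e^{-2\pi \mathbf{i}/p}$. For $\mathcal{A}\in\mathbb{C}^{n\times n\times p}$ one has $\mathrm{bcirc}(\mathcal{A})=(F_p\otimes I_n)\,\mathrm{diag}(B^{(1)},\dots,B^{(p)})\,(F_p^H\otimes I_n)$ with $B^{(i)}\in\mathbb{C}^{n\times n}$; the T-eigenvalues of $\mathcal{A}$ are the diagonal entries $\lambda^{(i)}_1,\dots,\lambda^{(i)}_n$ of the Jordan canonical forms of $B^{(i)}$, $i=1,\dots,p$ (i.e. the eigenvalues of the $B^{(i)}$, with algebraic multiplicity). The convergence radius $\rho$ may be $+\infty$. *)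

theory Defs
  imports
    "HOL-Analysis.Summation_Tests"
    "Jordan_Normal_Form.Jordan_Normal_Form"
    "Jordan_Normal_Form.Schur_Decomposition"
begin

text \<open>
  A third-order tensor is the list of its frontal slices. All indices start at 0: the slices of an
  \<open>m \<times> n \<times> p\<close> tensor are \<open>A ! 0, \<dots>, A ! (p - 1)\<close>. Dimensions are read off the list and its first
  slice, so the operations below are meant for nonempty lists.
\<close>

type_synonym tensor = "complex mat list"

definition carrier_tensor :: "nat \<Rightarrow> nat \<Rightarrow> nat \<Rightarrow> tensor set" where
  "carrier_tensor m n p = {A. length A = p \<and> set A \<subseteq> carrier_mat m n}"

text \<open>On natural numbers \<open>(i - j) mod p\<close> is computed as \<open>(p + i - j) mod p\<close>, as \<open>j < p\<close>.\<close>

definition bcirc :: "tensor \<Rightarrow> complex mat" where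
  "bcirc A = (let p = length A; m = dim_row (hd A); n = dim_col (hd A) in
     mat (m * p) (n * p)
       (\<lambda>(r, c). A ! ((p + r div m - c div n) mod p) $$ (r mod m, c mod n)))"

definition unfold_tensor :: "tensor \<Rightarrow> complex mat" where
  "unfold_tensor A = (let p = length A; m = dim_row (hd A); n = dim_col (hd A) in
     mat (m * p) n (\<lambda>(r, c). A ! (r div m) $$ (r mod m, c)))"

definition fold_tensor :: "nat \<Rightarrow> complex mat \<Rightarrow> tensor" where
  "fold_tensor p M = (let m = dim_row M div p in
     map (\<lambda>l. mat m (dim_col M) (\<lambda>(r, c). M $$ (l * m + r, c))) [0..<p])"

definition t_prod :: "tensor \<Rightarrow> tensor \<Rightarrow> tensor" where
  "t_prod A B = fold_tensor (length A) (bcirc A * unfold_tensor B)"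

definition t_id :: "nat \<Rightarrow> nat \<Rightarrow> tensor" where
  "t_id n p = 1\<^sub>m n # replicate (p - 1) (0\<^sub>m n n)"

fun t_pow :: "tensor \<Rightarrow> nat \<Rightarrow> tensor" where
  "t_pow A 0 = t_id (dim_row (hd A)) (length A)"
| "t_pow A (Suc k) = t_prod (t_pow A k) A"

definition t_smult :: "complex \<Rightarrow> tensor \<Rightarrow> tensor" where
  "t_smult c A = map (\<lambda>X. c \<cdot>\<^sub>m X) A"

text \<open>Convergence of a series of tensors in the finite-dimensional space of
  \<open>m \<times> n \<times> p\<close> tensors, i.e. convergence of the partial sums in every entry.\<close>

definition t_sums :: "nat \<Rightarrow> nat \<Rightarrow> nat \<Rightarrow> (nat \<Rightarrow> tensor) \<Rightarrow> tensor \<Rightarrow> bool" where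
  "t_sums m n p T S \<longleftrightarrow> S \<in> carrier_tensor m n p \<and>
     (\<forall>l<p. \<forall>i<m. \<forall>j<n. (\<lambda>k. T k ! l $$ (i, j)) sums (S ! l $$ (i, j)))"

definition kronecker :: "complex mat \<Rightarrow> complex mat \<Rightarrow> complex mat" where
  "kronecker A B = mat (dim_row A * dim_row B) (dim_col A * dim_col B)
     (\<lambda>(r, c). A $$ (r div dim_row B, c div dim_col B) * B $$ (r mod dim_row B, c mod dim_col B))"

definition fourier_mat :: "nat \<Rightarrow> complex mat" where
  "fourier_mat p = mat p p
     (\<lambda>(j, k). exp (- 2 * complex_of_real pi * \<i> / of_nat p) ^ (j * k) / complex_of_real (sqrt (real p)))"

definition fourier_blocks :: "nat \<Rightarrow> nat \<Rightarrow> tensor \<Rightarrow> complex mat list \<Rightarrow> bool" where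
  "fourier_blocks n p A Bs \<longleftrightarrow> length Bs = p \<and> set Bs \<subseteq> carrier_mat n n \<and>
     bcirc A = kronecker (fourier_mat p) (1\<^sub>m n) * diag_block_mat Bs *
               kronecker (mat_adjoint (fourier_mat p)) (1\<^sub>m n)"

text \<open>
  \<open>t_eigenvalues n p A ev\<close>: the family \<open>ev i j\<close> with \<open>i < p\<close>, \<open>j < n\<close> lists the T-eigenvalues of the
  \<open>n \<times> n \<times> p\<close> tensor \<open>A\<close>, where \<open>ev i 0, \<dots>, ev i (n - 1)\<close> are the diagonal entries of a Jordan
  canonical form of the \<open>i\<close>-th block, with multiplicity. A Jordan form is unique only up to the order
  of its Jordan blocks, so the order of the entries within a block is left open.
\<close>

definition t_eigenvalues :: "nat \<Rightarrow> nat \<Rightarrow> tensor \<Rightarrow> (nat \<Rightarrow> nat \<Rightarrow> complex) \<Rightarrow> bool" where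
  "t_eigenvalues n p A ev \<longleftrightarrow> (\<exists>Bs. fourier_blocks n p A Bs \<and>
     (\<forall>i<p. \<exists>n_as. jordan_nf (Bs ! i) n_as \<and>
        mset (map (ev i) [0..<n]) = mset (diag_mat (jordan_matrix n_as))))"

end

theory Submission
  imports Defs "Jordan_Normal_Form.Jordan_Normal_Form_Existence"
begin

text \<open>
  The discrete Fourier transform along the third dimension turns the T-product into \<open>p\<close> independent
  matrix products. Comparing entries in the block diagonalisation of \<open>bcirc A\<close> shows that matrices
  \<open>B\<^sub>0, \<dots>, B\<^sub>p\<^sub>-\<^sub>1\<close> are Fourier blocks of \<open>A\<close> precisely if the slices of \<open>A\<close> are their inverse transform,
  that is, slice \<open>l\<close> equals \<open>(1/p) \<Sum>\<^sub>k \<omega>\<^bsup>lk\<^esup> B\<^sub>k\<close> (\<open>fourier_blocks_iff\<close>). Orthogonality of the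
  characters \<open>m \<mapsto> \<omega>\<^bsup>mk\<^esup>\<close> then says that T-multiplication of tensors is blockwise multiplication of
  their Fourier blocks (\<open>t_prod_block_idft\<close>), so the blocks of \<open>A\<^bsup>k\<^esup>\<close> are the \<open>B\<^sub>i\<^bsup>k\<^esup>\<close>. Since the
  inverse transform is a finite linear combination, the tensor power series converges as soon as
  every \<open>\<Sum>\<^sub>k a\<^sub>k B\<^sub>i\<^bsup>k\<^esup>\<close> does, and these sums are the Fourier blocks of its limit
  (\<open>t_sums_block_idft\<close>).

  It remains to treat one complex matrix \<open>B\<close> (\<open>jordan_nf_mat_series\<close>). It is similar to its upper
  triangular Jordan matrix \<open>J\<close>, whose diagonal has modulus below some \<open>r\<close> inside the disc of
  convergence. Then \<open>J/r\<close> has bounded powers, so the entries of \<open>J\<^bsup>k\<^esup>\<close> are \<open>O(r\<^bsup>k\<^esup>)\<close> and the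
  series of \<open>J\<close> converges absolutely. Its sum is again upper triangular, with diagonal
  \<open>\<Sum>\<^sub>k a\<^sub>k \<lambda>\<^bsup>k\<^esup>\<close>, and conjugation passes through the series. Hence the sum for \<open>B\<close> is similar to
  a triangular matrix with the claimed diagonal. The diagonal of any of its Jordan forms is the same
  multiset, since both are the multiset of roots of the characteristic polynomial
  (\<open>mset_diag_jordan_nf\<close>).
\<close>

section \<open>Roots of unity\<close>

definition dft_root :: "nat \<Rightarrow> complex" where
  "dft_root p = exp (- 2 * complex_of_real pi * \<i> / of_nat p)"

lemma dft_root_power: "dft_root p ^ k = cnj (cis (2 * pi * real k / real p))"
proof -
  have "dft_root p = cis (- 2 * pi / real p)"
    unfolding dft_root_def cis_conv_exp by (simp add: field_simps)
  then show ?thesis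
    by (simp add: DeMoivre cis_cnj mult.commute)
qed

lemma dft_root_power_order: "p \<ge> 1 \<Longrightarrow> dft_root p ^ p = 1"
  by (simp add: dft_root_power)

lemma dft_root_nonzero: "dft_root p \<noteq> 0"
  by (simp add: dft_root_def)

lemma cnj_dft_root: "cnj (dft_root p) = inverse (dft_root p)"
  using dft_root_power[of p 1] by (simp add: cis_cnj)

lemma dft_root_power_inj:
  assumes "k < p" "k' < p" "dft_root p ^ k = dft_root p ^ k'"
  shows "k = k'"
proof -
  have "inj_on (\<lambda>k. cis (2 * pi * real k / real p)) {..<p}"
    using bij_betw_roots_unity[of p] assms(1) by (auto simp: bij_betw_def)
  then show ?thesis
    using assms by (auto simp: dft_root_power complex_cnj_cancel_iff dest: inj_onD)
qed

text \<open>
  The index \<open>(p + a - b) mod p\<close> is the natural number form of \<open>a - b\<close> modulo \<open>p\<close>, as it occurs in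
  block circulant matrices. Since \<open>\<omega>\<close> has order \<open>p\<close>, reducing the exponent changes nothing and the
  dependence on \<open>a\<close> and \<open>b\<close> separates.
\<close>

lemma dft_root_shift:
  assumes "p \<ge> 1" "b < p"
  shows "dft_root p ^ ((p + a - b) mod p * k) = dft_root p ^ (a * k) * inverse (dft_root p) ^ (b * k)"
proof -
  have *: "dft_root p ^ (x mod p) = dft_root p ^ x" for x
  proof -
    have "dft_root p ^ x = dft_root p ^ (p * (x div p) + x mod p)" by simp
    also have "\<dots> = dft_root p ^ (x mod p)"
      by (simp only: power_add power_mult dft_root_power_order[OF assms(1)]) simp
    finally show ?thesis by simp
  qed
  have "dft_root p ^ (p + a - b) * dft_root p ^ b = dft_root p ^ a"
    using assms by (simp add: power_add[symmetric]) (simp add: power_add dft_root_power_order)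
  then have "dft_root p ^ (p + a - b) = dft_root p ^ a * inverse (dft_root p) ^ b"
    by (simp add: field_simps dft_root_nonzero)
  then show ?thesis
    by (simp add: power_mult * power_mult_distrib)
qed

text \<open>
  The sum is geometric with ratio \<open>\<omega>\<^bsup>k' - k\<^esup>\<close>, which is a \<open>p\<close>-th root of unity and equals 1
  only for \<open>k = k'\<close>.
\<close>

lemma dft_root_orthogonal:
  assumes "k < p" "k' < p"
  shows "(\<Sum>m<p. inverse (dft_root p) ^ (m * k) * dft_root p ^ (m * k')) = (if k = k' then of_nat p else 0)"
proof -
  define x where "x = dft_root p ^ k' / dft_root p ^ k"
  have pow: "inverse (dft_root p) ^ (m * k) * dft_root p ^ (m * k') = x ^ m" for m
    unfolding x_def by (simp add: power_divide power_mult[symmetric] mult.commute field_simps)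
  have "x ^ p = (dft_root p ^ p) ^ k' / (dft_root p ^ p) ^ k"
    unfolding x_def by (simp add: power_divide power_mult[symmetric] mult.commute)
  then have "x ^ p = 1"
    using assms by (simp add: dft_root_power_order)
  moreover have "x = 1 \<longleftrightarrow> k = k'"
    unfolding x_def using dft_root_power_inj[OF assms] dft_root_nonzero[of p] by auto
  ultimately show ?thesis
    unfolding pow by (simp add: sum_gp_strict)
qed

section \<open>Block matrices with blocks of equal size\<close>

lemma index_mult_mat_sum:
  assumes "A \<in> carrier_mat m n" "B \<in> carrier_mat n s" "i < m" "j < s"
  shows "(A * B) $$ (i, j) = (\<Sum>u<n. A $$ (i, u) * B $$ (u, j))"
  using assms by (simp add: scalar_prod_def atLeast0LessThan)

lemma sum_over_blocks: "(\<Sum>t<p * n. f t) = (\<Sum>m<p. \<Sum>u<n. f (m * n + u))" for f :: "nat \<Rightarrow> 'a::comm_monoid_add"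
proof -
  have "sum f {m * n..<m * n + n} = (\<Sum>u<n. f (m * n + u))" for m
    using sum.shift_bounds_nat_ivl[of f 0 "m * n" n] by (simp add: atLeast0LessThan add.commute)
  then show ?thesis
    using sum.nat_group[of f n p] by simp
qed

lemma block_index_less: "m < p \<Longrightarrow> u < n \<Longrightarrow> m * n + u < n * p" for m n p u :: nat
proof -
  assume "m < p" "u < n"
  then have "m * n + u < Suc m * n" by simp
  also have "\<dots> \<le> p * n" using \<open>m < p\<close> by (intro mult_le_mono1) simp
  finally show ?thesis by (simp add: mult.commute)
qed

lemma dim_diag_block_mat_uniform:
  assumes "set Bs \<subseteq> carrier_mat n n"
  shows "diag_block_mat Bs \<in> carrier_mat (n * length Bs) (n * length Bs)"
proof -
  have "sum_list (map dim_row Bs) = n * length Bs" "sum_list (map dim_col Bs) = n * length Bs"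
    using assms by (induction Bs) auto
  then show ?thesis
    by (intro carrier_matI) (simp_all add: dim_diag_block_mat)
qed

lemma index_diag_block_mat_uniform:
  assumes "set Bs \<subseteq> carrier_mat n n" "m < length Bs" "m' < length Bs" "u < n" "v < n"
  shows "diag_block_mat Bs $$ (m * n + u, m' * n + v) = (if m = m' then (Bs ! m) $$ (u, v) else 0)"
  using assms
proof (induction Bs arbitrary: m m')
  case (Cons B Bs)
  let ?D = "diag_block_mat Bs"
  have D: "?D \<in> carrier_mat (n * length Bs) (n * length Bs)" and B: "B \<in> carrier_mat n n"
    using dim_diag_block_mat_uniform Cons.prems(1) by auto
  have lt: "m * n + u < n * Suc (length Bs)" "m' * n + v < n * Suc (length Bs)"
    using block_index_less[of m "Suc (length Bs)" u n] block_index_less[of m' "Suc (length Bs)" v n] Cons.prems by auto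
  have IH: "k < length Bs \<Longrightarrow> k' < length Bs \<Longrightarrow>
      ?D $$ (k * n + u, k' * n + v) = (if k = k' then (Bs ! k) $$ (u, v) else 0)" for k k'
    using Cons by auto
  show ?case
    using Cons.prems lt D B IH
    by (cases m; cases m') (auto simp: Let_def)
qed simp

lemma index_kronecker_one:
  assumes "X \<in> carrier_mat p q" "m < p" "m' < q" "u < n" "v < n"
  shows "kronecker X (1\<^sub>m n) $$ (m * n + u, m' * n + v) = (if u = v then X $$ (m, m') else 0)"
proof -
  have "m * n + u < dim_row X * n" "m' * n + v < dim_col X * n"
    using assms block_index_less[OF assms(2,4)] block_index_less[OF assms(3,5)]
    by (simp_all add: mult.commute[of n])
  moreover have "(m * n + u) div n = m" "(m' * n + v) div n = m'"
    using assms by simp_all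
  ultimately show ?thesis
    using assms by (simp add: kronecker_def)
qed

lemma kronecker_one_carrier: "X \<in> carrier_mat p q \<Longrightarrow> kronecker X (1\<^sub>m n) \<in> carrier_mat (n * p) (n * q)"
  by (rule carrier_matI) (simp_all add: kronecker_def mult.commute[of n])

text \<open>
  The factors \<open>1\<^sub>m n\<close> leave the position inside a block alone, so the product acts on each fixed
  position \<open>(i, j)\<close> like \<open>X \<cdot> diag \<cdot> Y\<close> with scalar entries.
\<close>

lemma index_kronecker_diag_kronecker:
  assumes X: "X \<in> carrier_mat p p" and Y: "Y \<in> carrier_mat p p"
    and Bs: "length Bs = p" "set Bs \<subseteq> carrier_mat n n"
    and lt: "a < p" "b < p" "i < n" "j < n"
  shows "(kronecker X (1\<^sub>m n) * diag_block_mat Bs * kronecker Y (1\<^sub>m n)) $$ (a * n + i, b * n + j)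
           = (\<Sum>k<p. X $$ (a, k) * (Bs ! k) $$ (i, j) * Y $$ (k, b))"
proof -
  let ?K = "kronecker X (1\<^sub>m n)" and ?D = "diag_block_mat Bs" and ?L = "kronecker Y (1\<^sub>m n)"
  have K: "?K \<in> carrier_mat (n * p) (n * p)" and D: "?D \<in> carrier_mat (n * p) (n * p)"
    and L: "?L \<in> carrier_mat (n * p) (n * p)"
    using kronecker_one_carrier X Y dim_diag_block_mat_uniform[OF Bs(2)] Bs(1) by auto
  note r = block_index_less[OF lt(1,3)] and c = block_index_less[OF lt(2,4)]
  have KD: "(?K * ?D) $$ (a * n + i, k * n + v) = X $$ (a, k) * (Bs ! k) $$ (i, v)"
    if "k < p" "v < n" for k v
  proof -
    have "(?K * ?D) $$ (a * n + i, k * n + v)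
        = (\<Sum>s<p * n. ?K $$ (a * n + i, s) * ?D $$ (s, k * n + v))"
      using index_mult_mat_sum[OF K D r block_index_less[OF that]] by (simp only: mult.commute[of n p])
    also have "\<dots> = (\<Sum>m<p. \<Sum>u<n. (if i = u then X $$ (a, m) else 0) * (if m = k then (Bs ! m) $$ (u, v) else 0))"
      unfolding sum_over_blocks using X Bs lt that
      by (intro sum.cong refl) (simp add: index_kronecker_one index_diag_block_mat_uniform)
    also have "\<dots> = (\<Sum>m<p. if m = k then X $$ (a, m) * (Bs ! m) $$ (i, v) else 0)"
      using lt by (intro sum.cong refl) (simp add: if_distrib[where f = "\<lambda>x. x * _"] sum.delta cong: if_cong)
    finally show ?thesis using that by simp
  qed
  have "(?K * ?D * ?L) $$ (a * n + i, b * n + j)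
      = (\<Sum>s<p * n. (?K * ?D) $$ (a * n + i, s) * ?L $$ (s, b * n + j))"
    using index_mult_mat_sum[OF mult_carrier_mat[OF K D] L r c] by (simp only: mult.commute[of n p])
  also have "\<dots> = (\<Sum>k<p. \<Sum>v<n. X $$ (a, k) * (Bs ! k) $$ (i, v) * (if v = j then Y $$ (k, b) else 0))"
    unfolding sum_over_blocks using Y lt
    by (intro sum.cong refl) (simp add: index_kronecker_one KD)
  also have "\<dots> = (\<Sum>k<p. X $$ (a, k) * (Bs ! k) $$ (i, j) * Y $$ (k, b))"
    using lt by (intro sum.cong refl) (simp add: if_distrib[where f = "\<lambda>x. _ * x"] sum.delta cong: if_cong)
  finally show ?thesis .
qed


section \<open>Tensor operations on slices\<close>

lemma carrier_tensorD:
  assumes "A \<in> carrier_tensor m n p"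
  shows "length A = p" "l < p \<Longrightarrow> A ! l \<in> carrier_mat m n"
    "p \<ge> 1 \<Longrightarrow> hd A \<in> carrier_mat m n"
proof -
  show len: "length A = p" using assms by (simp add: carrier_tensor_def)
  show nth: "l < p \<Longrightarrow> A ! l \<in> carrier_mat m n" for l
    using assms nth_mem[of l A] by (auto simp: carrier_tensor_def)
  show "p \<ge> 1 \<Longrightarrow> hd A \<in> carrier_mat m n"
    using nth[of 0] len by (cases A) auto
qed

lemma tensor_eqI:
  assumes "A \<in> carrier_tensor m n p" "B \<in> carrier_tensor m n p"
    and "\<And>l i j. \<lbrakk>l < p; i < m; j < n\<rbrakk> \<Longrightarrow> A ! l $$ (i, j) = B ! l $$ (i, j)"
  shows "A = B"
proof (rule nth_equalityI)
  note DA = carrier_tensorD[OF assms(1)] and DB = carrier_tensorD[OF assms(2)]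
  show "length A = length B" using DA DB by simp
  fix l assume "l < length A"
  then have l: "l < p" using DA by simp
  show "A ! l = B ! l"
    using carrier_matD[OF DA(2)[OF l]] carrier_matD[OF DB(2)[OF l]] assms(3)[OF l]
    by (intro eq_matI) auto
qed

lemma bcirc_carrier:
  "\<lbrakk>p \<ge> 1; A \<in> carrier_tensor m n p\<rbrakk> \<Longrightarrow> bcirc A \<in> carrier_mat (m * p) (n * p)"
  using carrier_tensorD[of A m n p] by (auto simp: bcirc_def Let_def)

lemma index_bcirc:
  assumes "A \<in> carrier_tensor m n p" "a < p" "b < p" "i < m" "j < n"
  shows "bcirc A $$ (a * m + i, b * n + j) = A ! ((p + a - b) mod p) $$ (i, j)"
proof -
  have "p \<ge> 1" using assms by simp
  then show ?thesis
    using carrier_tensorD[OF assms(1)] block_index_less[OF assms(2,4)] block_index_less[OF assms(3,5)] assms(4,5)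
    by (simp add: bcirc_def Let_def)
qed

text \<open>The T-product is the cyclic convolution of the slices.\<close>

lemma index_t_prod:
  assumes A: "A \<in> carrier_tensor m n p" and B: "B \<in> carrier_tensor n s p"
    and lt: "l < p" "i < m" "j < s"
  shows "t_prod A B ! l $$ (i, j) = (\<Sum>k<p. \<Sum>u<n. A ! ((p + l - k) mod p) $$ (i, u) * B ! k $$ (u, j))"
proof -
  have p: "p \<ge> 1" using lt by simp
  note DA = carrier_tensorD[OF A] and DB = carrier_tensorD[OF B]
  have K: "bcirc A \<in> carrier_mat (m * p) (n * p)"
    by (rule bcirc_carrier[OF p A])
  have U: "unfold_tensor B \<in> carrier_mat (n * p) s"
    using p DB by (auto simp: unfold_tensor_def Let_def)
  have idx: "unfold_tensor B $$ (k * n + u, j) = B ! k $$ (u, j)" if "k < p" "u < n" for k u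
    using p DB block_index_less[OF that] lt that by (simp add: unfold_tensor_def Let_def)
  have "t_prod A B ! l $$ (i, j) = (bcirc A * unfold_tensor B) $$ (l * m + i, j)"
    using K U lt p DA by (simp add: t_prod_def fold_tensor_def Let_def)
  also have "\<dots> = (\<Sum>t<p * n. bcirc A $$ (l * m + i, t) * unfold_tensor B $$ (t, j))"
    using index_mult_mat_sum[OF K U block_index_less[OF lt(1,2)] lt(3)] by (simp only: mult.commute[of n p])
  also have "\<dots> = (\<Sum>k<p. \<Sum>u<n. A ! ((p + l - k) mod p) $$ (i, u) * B ! k $$ (u, j))"
    unfolding sum_over_blocks using lt by (intro sum.cong refl) (simp add: index_bcirc[OF A] idx)
  finally show ?thesis .
qed

lemma t_prod_carrier:
  assumes "p \<ge> 1" "A \<in> carrier_tensor m n p" "B \<in> carrier_tensor n s p"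
  shows "t_prod A B \<in> carrier_tensor m s p"
  using assms carrier_tensorD[OF assms(2)] carrier_tensorD[OF assms(3)] bcirc_carrier[OF assms(1,2)]
  by (auto simp: t_prod_def fold_tensor_def carrier_tensor_def unfold_tensor_def Let_def)

section \<open>Fourier blocks as an inverse Fourier transform\<close>

text \<open>The inverse discrete Fourier transform of a family of \<open>p\<close> matrices, applied entry by entry.\<close>

definition block_idft :: "nat \<Rightarrow> nat \<Rightarrow> (nat \<Rightarrow> complex mat) \<Rightarrow> tensor" where
  "block_idft n p B = map (\<lambda>l. mat n n (\<lambda>(i, j).
     (\<Sum>k<p. dft_root p ^ (l * k) * B k $$ (i, j)) / of_nat p)) [0..<p]"

lemma block_idft_carrier: "block_idft n p B \<in> carrier_tensor n n p"
  by (auto simp: block_idft_def carrier_tensor_def)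

lemma index_block_idft:
  "\<lbrakk>l < p; i < n; j < n\<rbrakk> \<Longrightarrow>
     block_idft n p B ! l $$ (i, j) = (\<Sum>k<p. dft_root p ^ (l * k) * B k $$ (i, j)) / of_nat p"
  by (simp add: block_idft_def)

lemma fourier_mat_carrier: "fourier_mat p \<in> carrier_mat p p"
  by (simp add: fourier_mat_def)

lemma adjoint_fourier_mat_carrier: "mat_adjoint (fourier_mat p) \<in> carrier_mat p p"
  by (rule carrier_matI) (simp_all add: mat_adjoint_def fourier_mat_def)

lemma index_fourier_mat:
  "\<lbrakk>a < p; k < p\<rbrakk> \<Longrightarrow> fourier_mat p $$ (a, k) = dft_root p ^ (a * k) / complex_of_real (sqrt (real p))"
  by (simp add: fourier_mat_def dft_root_def)

lemma index_adjoint_fourier_mat: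
  "\<lbrakk>k < p; b < p\<rbrakk> \<Longrightarrow> mat_adjoint (fourier_mat p) $$ (k, b)
     = inverse (dft_root p) ^ (b * k) / complex_of_real (sqrt (real p))"
  using index_fourier_mat[of b p k] cnj_dft_root[of p] fourier_mat_carrier[of p]
  by (simp add: mat_adjoint_def mat_of_rows_def)

text \<open>
  Block \<open>(a, b)\<close> of the factorised matrix is \<open>(1/p) \<Sum>\<^sub>k \<omega>\<^bsup>(a - b)k\<^esup> B\<^sub>k\<close>. It depends on \<open>a - b\<close>
  modulo \<open>p\<close> only, so the factorisation always describes a block circulant matrix, and the first
  block column determines the tensor.
\<close>

lemma fourier_blocks_iff:
  assumes p: "p \<ge> 1" and A: "A \<in> carrier_tensor n n p"
  shows "fourier_blocks n p A Bs \<longleftrightarrow>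
    length Bs = p \<and> set Bs \<subseteq> carrier_mat n n \<and> A = block_idft n p ((!) Bs)"
proof (cases "length Bs = p \<and> set Bs \<subseteq> carrier_mat n n")
  case True
  let ?I = "block_idft n p ((!) Bs)"
  let ?R = "kronecker (fourier_mat p) (1\<^sub>m n) * diag_block_mat Bs * kronecker (mat_adjoint (fourier_mat p)) (1\<^sub>m n)"
  have sqrt: "complex_of_real (sqrt (real p)) * complex_of_real (sqrt (real p)) = of_nat p"
    by (simp flip: of_real_mult)
  have R: "?R \<in> carrier_mat (n * p) (n * p)"
    using kronecker_one_carrier[OF fourier_mat_carrier[of p], of n]
      kronecker_one_carrier[OF adjoint_fourier_mat_carrier[of p], of n] by auto
  have idx: "?R $$ (a * n + i, b * n + j) = ?I ! ((p + a - b) mod p) $$ (i, j)"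
    if lt: "a < p" "b < p" "i < n" "j < n" for a b i j
  proof -
    have "?R $$ (a * n + i, b * n + j) = (\<Sum>k<p. dft_root p ^ (a * k) / complex_of_real (sqrt (real p)) * (Bs ! k) $$ (i, j) *
        (inverse (dft_root p) ^ (b * k) / complex_of_real (sqrt (real p))))"
      using True lt by (subst index_kronecker_diag_kronecker[OF fourier_mat_carrier adjoint_fourier_mat_carrier])
        (simp_all add: index_fourier_mat index_adjoint_fourier_mat)
    also have "\<dots> = (\<Sum>k<p. dft_root p ^ (a * k) * inverse (dft_root p) ^ (b * k) * (Bs ! k) $$ (i, j)) / of_nat p"
      unfolding sum_divide_distrib sqrt[symmetric] by (intro sum.cong refl) (simp add: field_simps)
    also have "\<dots> = ?I ! ((p + a - b) mod p) $$ (i, j)"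
      using lt p by (simp add: index_block_idft dft_root_shift)
    finally show ?thesis .
  qed
  have "bcirc ?I = ?R"
  proof (rule eq_matI)
    fix r c assume rc: "r < dim_row ?R" "c < dim_col ?R"
    then have rc: "r < n * p" "c < n * p" using R by auto
    then have "n > 0" by (cases n) auto
    then have "?R $$ (r div n * n + r mod n, c div n * n + c mod n) = bcirc ?I $$ (r div n * n + r mod n, c div n * n + c mod n)"
      using rc by (subst idx; (subst index_bcirc[OF block_idft_carrier])?)
        (simp_all add: less_mult_imp_div_less mult.commute)
    then show "bcirc ?I $$ (r, c) = ?R $$ (r, c)" by simp
  qed (use carrier_matD[OF R] carrier_matD[OF bcirc_carrier[OF p block_idft_carrier[of n p "(!) Bs"]]] in simp_all)
  moreover have "A = ?I" if "bcirc A = bcirc ?I"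
  proof (rule tensor_eqI[OF A block_idft_carrier])
    fix l i j assume lt: "l < p" "i < n" "j < n"
    show "A ! l $$ (i, j) = ?I ! l $$ (i, j)"
      using index_bcirc[OF A lt(1) _ lt(2,3), of 0] index_bcirc[OF block_idft_carrier[of n p "(!) Bs"] lt(1) _ lt(2,3), of 0]
        that lt by simp
  qed
  ultimately show ?thesis
    using True by (auto simp: fourier_blocks_def)
qed (auto simp: fourier_blocks_def)

text \<open>
  The convolution theorem. In the cyclic convolution of the two inverse transforms, orthogonality
  removes every mixed term \<open>B k * C k'\<close> with \<open>k \<noteq> k'\<close>.
\<close>

lemma t_prod_block_idft:
  assumes p: "p \<ge> 1" and B: "\<And>k. k < p \<Longrightarrow> B k \<in> carrier_mat n n" and C: "\<And>k. k < p \<Longrightarrow> C k \<in> carrier_mat n n"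
  shows "t_prod (block_idft n p B) (block_idft n p C) = block_idft n p (\<lambda>k. B k * C k)"
proof (rule tensor_eqI[OF t_prod_carrier[OF p] block_idft_carrier])
  fix l i j assume lt: "l < p" "i < n" "j < n"
  let ?w = "dft_root p"
  have "t_prod (block_idft n p B) (block_idft n p C) ! l $$ (i, j)
      = (\<Sum>m<p. \<Sum>u<n. (\<Sum>k<p. ?w ^ ((p + l - m) mod p * k) * B k $$ (i, u)) / of_nat p
            * ((\<Sum>k'<p. ?w ^ (m * k') * C k' $$ (u, j)) / of_nat p))"
    using lt by (simp add: index_t_prod[OF block_idft_carrier block_idft_carrier] index_block_idft)
  also have "\<dots> = (\<Sum>m<p. \<Sum>u<n. \<Sum>k<p. \<Sum>k'<p. ?w ^ (l * k) * (B k $$ (i, u) * C k' $$ (u, j))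
            * (inverse ?w ^ (m * k) * ?w ^ (m * k'))) / (of_nat p * of_nat p)"
    unfolding sum_divide_distrib sum_product times_divide_times_eq
    using dft_root_shift[OF p, of _ l] by (intro sum.cong refl) (simp add: mult_ac)
  also have "\<dots> = (\<Sum>u<n. \<Sum>k<p. \<Sum>k'<p. ?w ^ (l * k) * (B k $$ (i, u) * C k' $$ (u, j))
            * (\<Sum>m<p. inverse ?w ^ (m * k) * ?w ^ (m * k'))) / (of_nat p * of_nat p)"
    unfolding sum_distrib_left
    by (subst sum.swap, subst (2) sum.swap, subst (3) sum.swap, rule refl)
  also have "\<dots> = (\<Sum>u<n. \<Sum>k<p. ?w ^ (l * k) * (B k $$ (i, u) * C k $$ (u, j)) * of_nat p) / (of_nat p * of_nat p)"
    by (intro arg_cong2[where f = "(/)"] sum.cong refl)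
      (simp add: dft_root_orthogonal if_distrib[where f = "\<lambda>x. _ * x"] cong: if_cong)
  also have "\<dots> = (\<Sum>k<p. ?w ^ (l * k) * (\<Sum>u<n. B k $$ (i, u) * C k $$ (u, j))) / of_nat p"
    unfolding sum_distrib_left sum_divide_distrib
    using p by (subst sum.swap) (intro sum.cong refl, simp)
  also have "\<dots> = block_idft n p (\<lambda>k. B k * C k) ! l $$ (i, j)"
    using lt by (simp add: index_block_idft index_mult_mat_sum[OF B C] del: index_mult_mat(1))
  finally show "t_prod (block_idft n p B) (block_idft n p C) ! l $$ (i, j)
    = block_idft n p (\<lambda>k. B k * C k) ! l $$ (i, j)" .
qed (rule block_idft_carrier)+

lemma t_id_eq_block_idft:
  assumes "p \<ge> 1"
  shows "t_id n p = block_idft n p (\<lambda>_. 1\<^sub>m n)"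
proof (rule tensor_eqI[OF _ block_idft_carrier])
  show "t_id n p \<in> carrier_tensor n n p"
    using assms by (auto simp: t_id_def carrier_tensor_def)
  fix l i j assume lt: "l < p" "i < n" "j < n"
  have "(\<Sum>k<p. dft_root p ^ (l * k)) = (if l = 0 then of_nat p else 0)"
    using dft_root_orthogonal[of 0 p l] lt by (simp add: mult.commute)
  then show "t_id n p ! l $$ (i, j) = block_idft n p (\<lambda>_. 1\<^sub>m n) ! l $$ (i, j)"
    using lt by (cases l) (auto simp: t_id_def index_block_idft simp flip: sum_distrib_right)
qed

lemma t_pow_block_idft:
  assumes p: "p \<ge> 1" and B: "\<And>k. k < p \<Longrightarrow> B k \<in> carrier_mat n n"
  shows "t_pow (block_idft n p B) r = block_idft n p (\<lambda>k. B k ^\<^sub>m r)"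
proof (induction r)
  case 0
  have "block_idft n p (\<lambda>_. 1\<^sub>m n) = block_idft n p (\<lambda>k. 1\<^sub>m (dim_row (B k)))"
    using carrier_matD(1)[OF B] by (intro tensor_eqI[OF block_idft_carrier block_idft_carrier]) (simp add: index_block_idft)
  then show ?case
    using p carrier_tensorD[OF block_idft_carrier[of n p B]] by (simp add: t_id_eq_block_idft)
next
  case (Suc r)
  then show ?case
    using t_prod_block_idft[of p "\<lambda>k. B k ^\<^sub>m r" n B] p B by simp
qed

section \<open>Power series of triangular matrices\<close>

lemma upper_triangular_pow:
  assumes T: "T \<in> carrier_mat n n" "upper_triangular (T :: 'a::comm_semiring_1 mat)"
  shows "\<lbrakk>j < i; i < n\<rbrakk> \<Longrightarrow> (T ^\<^sub>m k) $$ (i, j) = 0"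
    and "i < n \<Longrightarrow> (T ^\<^sub>m k) $$ (i, i) = T $$ (i, i) ^ k"
proof -
  have "(\<forall>i<n. (\<forall>j<i. (T ^\<^sub>m k) $$ (i, j) = 0) \<and> (T ^\<^sub>m k) $$ (i, i) = T $$ (i, i) ^ k)"
  proof (induction k)
    case 0
    show ?case using T by auto
  next
    case (Suc k)
    have mult: "(T ^\<^sub>m Suc k) $$ (i, j) = (\<Sum>u<n. (T ^\<^sub>m k) $$ (i, u) * T $$ (u, j))" if "i < n" "j < n" for i j
      using index_mult_mat_sum[OF pow_carrier_mat[OF T(1)] T(1) that] by simp
    have zero: "(T ^\<^sub>m k) $$ (i, u) * T $$ (u, j) = 0" if "i < n" "u < n" "j \<le> i" "u \<noteq> i \<or> j \<noteq> i" for i j u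
      using that Suc upper_triangularD[OF T(2), of j u] T(1) by (cases "u < i") auto
    show ?case
    proof (intro allI impI conjI)
      fix i j assume "i < n" "j < i"
      then show "(T ^\<^sub>m Suc k) $$ (i, j) = 0" using zero by (subst mult) (auto intro!: sum.neutral)
    next
      fix i assume i: "i < n"
      have "(\<Sum>u<n. (T ^\<^sub>m k) $$ (i, u) * T $$ (u, i)) = (\<Sum>u<n. if u = i then (T ^\<^sub>m k) $$ (i, i) * T $$ (i, i) else 0)"
        using i zero by (intro sum.cong) auto
      then show "(T ^\<^sub>m Suc k) $$ (i, i) = T $$ (i, i) ^ Suc k"
        using i Suc by (subst mult) (auto simp: mult.commute)
    qed
  qed
  then show "\<lbrakk>j < i; i < n\<rbrakk> \<Longrightarrow> (T ^\<^sub>m k) $$ (i, j) = 0"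
    and "i < n \<Longrightarrow> (T ^\<^sub>m k) $$ (i, i) = T $$ (i, i) ^ k" by auto
qed

lemma smult_pow_mat: "A \<in> carrier_mat n n \<Longrightarrow> (c \<cdot>\<^sub>m A) ^\<^sub>m k = c ^ k \<cdot>\<^sub>m (A ^\<^sub>m k)" for c :: "'a::comm_ring_1"
proof (induction k)
  case (Suc k)
  then show ?case
    by (simp add: mult_smult_distrib[of _ n n _ n] mult_smult_assoc_mat[of _ n n _ n])
      (auto intro!: eq_matI)
qed auto

text \<open>
  After division by \<open>r\<close> every diagonal entry has modulus below 1. A triangular matrix of that kind
  has bounded powers.
\<close>

lemma upper_triangular_pow_bound:
  fixes T :: "complex mat"
  assumes T: "T \<in> carrier_mat n n" "upper_triangular T"
    and r: "r > 0" "\<And>i. i < n \<Longrightarrow> cmod (T $$ (i, i)) < r"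
  shows "\<exists>c. \<forall>k. \<forall>i<n. \<forall>j<n. cmod ((T ^\<^sub>m k) $$ (i, j)) \<le> c * r ^ k"
proof -
  let ?s = "complex_of_real (1 / r)"
  let ?S = "?s \<cdot>\<^sub>m T"
  have S: "?S \<in> carrier_mat n n" "upper_triangular ?S"
    using T upper_triangularD[OF T(2)] by (auto intro!: upper_triangularI)
  have lt: "cmod x < 1" if "x \<in> set (diag_mat ?S)" for x
    using that r T by (auto simp: diag_mat_def norm_mult norm_divide divide_simps)
  \<comment> \<open>No diagonal entry has modulus 1, so the polynomial growth bound has degree 0.\<close>
  obtain c1 c2 where bound: "\<And>k. norm_bound (?S ^\<^sub>m k) (c1 + c2 * of_nat k ^ (0 - 1))"
    using counting_ones_complexity[OF S, of 0] lt by (metis less_irrefl less_imp_le)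
  show ?thesis
  proof (intro exI allI impI)
    fix k i j assume ij: "i < n" "j < n"
    have "cmod ((?S ^\<^sub>m k) $$ (i, j)) \<le> c1 + c2"
      using bound[of k] pow_mat_dim_square[OF S(1), of k] ij unfolding norm_bound_def by simp
    then show "cmod ((T ^\<^sub>m k) $$ (i, j)) \<le> (c1 + c2) * r ^ k"
      using T ij r by (simp add: smult_pow_mat norm_mult norm_power norm_divide power_divide field_simps)
  qed
qed

text \<open>
  The entrywise sum of \<open>a\<^sub>k B\<^bsup>k\<^esup>\<close>. Entries whose series diverges carry an arbitrary value, so statements
  about it come with summability of the entries where that matters.
\<close>

definition mat_series :: "(nat \<Rightarrow> complex) \<Rightarrow> complex mat \<Rightarrow> complex mat" where
  "mat_series a B = mat (dim_row B) (dim_row B) (\<lambda>(i, j). \<Sum>k. a k * (B ^\<^sub>m k) $$ (i, j))"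

lemma mat_series_carrier: "B \<in> carrier_mat n n \<Longrightarrow> mat_series a B \<in> carrier_mat n n"
  by (auto simp: mat_series_def)

lemma upper_triangular_mat_series_summable:
  fixes T :: "complex mat"
  assumes T: "T \<in> carrier_mat n n" "upper_triangular T"
    and r: "r > 0" "\<And>i. i < n \<Longrightarrow> cmod (T $$ (i, i)) < r" "ereal r < conv_radius a"
    and ij: "i < n" "j < n"
  shows "summable (\<lambda>k. a k * (T ^\<^sub>m k) $$ (i, j))"
proof -
  obtain c where c: "\<And>k. cmod ((T ^\<^sub>m k) $$ (i, j)) \<le> c * r ^ k"
    using upper_triangular_pow_bound[OF T r(1,2)] ij by blast
  have "summable (\<lambda>k. c * norm (a k * complex_of_real r ^ k))"
    using r abs_summable_in_conv_radius[of "complex_of_real r" a] by (intro summable_mult) simp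
  then show ?thesis
  proof (rule summable_comparison_test')
    fix k
    show "norm (a k * (T ^\<^sub>m k) $$ (i, j)) \<le> c * norm (a k * complex_of_real r ^ k)"
      using mult_left_mono[OF c[of k], of "cmod (a k)"] r by (simp add: norm_mult norm_power mult_ac)
  qed
qed

section \<open>Power series and similarity\<close>

lemma index_conjugation:
  assumes "P \<in> carrier_mat n n" "M \<in> carrier_mat n n" "Q \<in> carrier_mat n n" "i < n" "j < n"
  shows "(P * M * Q) $$ (i, j) = (\<Sum>v<n. \<Sum>u<n. P $$ (i, u) * M $$ (u, v) * Q $$ (v, j))"
  using assms by (simp add: index_mult_mat_sum[of _ n n _ n] mult_carrier_mat[of _ n n] sum_distrib_right
    del: index_mult_mat(1) assoc_mult_mat)

text \<open>
  Each entry of \<open>B\<^bsup>k\<^esup> = P T\<^bsup>k\<^esup> Q\<close> is a finite linear combination of entries of \<open>T\<^bsup>k\<^esup>\<close>, with coefficients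
  independent of \<open>k\<close>. So convergence and the value of the sum carry over from \<open>T\<close> to \<open>B\<close>.
\<close>

lemma mat_series_similar:
  assumes wit: "similar_mat_wit B T P Q" and B: "B \<in> carrier_mat n n"
    and summ: "\<And>i j. \<lbrakk>i < n; j < n\<rbrakk> \<Longrightarrow> summable (\<lambda>k. a k * (T ^\<^sub>m k) $$ (i, j))"
  shows "\<lbrakk>i < n; j < n\<rbrakk> \<Longrightarrow> summable (\<lambda>k. a k * (B ^\<^sub>m k) $$ (i, j))"
    and "similar_mat (mat_series a B) (mat_series a T)"
proof -
  note W = similar_mat_witD2[OF B wit]
  have entry: "a k * (B ^\<^sub>m k) $$ (i, j) = (\<Sum>v<n. \<Sum>u<n. P $$ (i, u) * (a k * (T ^\<^sub>m k) $$ (u, v)) * Q $$ (v, j))"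
    if "i < n" "j < n" for i j k
    unfolding similar_mat_wit_pow_id[OF wit]
    using W that by (simp add: index_conjugation[of P n _ Q] sum_distrib_left mult_ac del: index_mult_mat)
  have sums: "(\<lambda>k. a k * (B ^\<^sub>m k) $$ (i, j)) sums
      (\<Sum>v<n. \<Sum>u<n. P $$ (i, u) * mat_series a T $$ (u, v) * Q $$ (v, j))" if "i < n" "j < n" for i j
    unfolding entry[OF that] mat_series_def
    using W summ by (auto intro!: sums_sum sums_mult sums_mult2 summable_sums)
  then show "\<lbrakk>i < n; j < n\<rbrakk> \<Longrightarrow> summable (\<lambda>k. a k * (B ^\<^sub>m k) $$ (i, j))"
    by (auto simp: sums_iff)
  have "mat_series a B = P * mat_series a T * Q"
  proof (rule eq_matI)
    fix i j assume "i < dim_row (P * mat_series a T * Q)" "j < dim_col (P * mat_series a T * Q)"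
    then have ij: "i < n" "j < n" using W by auto
    then show "mat_series a B $$ (i, j) = (P * mat_series a T * Q) $$ (i, j)"
      using W B sums[OF ij] by (subst index_conjugation[of _ n]) (auto simp: mat_series_carrier, simp add: mat_series_def sums_iff)
  qed (use W B in \<open>auto simp: mat_series_def\<close>)
  then have "similar_mat_wit (mat_series a B) (mat_series a T) P Q"
    using W B by (intro similar_mat_witI[of _ _ n]) (auto simp: mat_series_carrier)
  then show "similar_mat (mat_series a B) (mat_series a T)"
    by (auto simp: similar_mat_def)
qed

text \<open>
  Powers of a triangular matrix are triangular with the powers of the diagonal entries on the
  diagonal. So below the diagonal all terms vanish, and on the diagonal both sides are the same series.
\<close>

lemma mat_series_upper_triangular:
  assumes T: "T \<in> carrier_mat n n" "upper_triangular T"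
  shows "upper_triangular (mat_series a T)"
    and "diag_mat (mat_series a T) = map (\<lambda>x. \<Sum>k. a k * x ^ k) (diag_mat T)"
  using T upper_triangular_pow[OF T]
  by (auto simp: mat_series_def diag_mat_def)

text \<open>
  A Jordan matrix of \<open>X\<close> and the triangular matrix \<open>T\<close> are similar, hence share their characteristic
  polynomial. It splits into linear factors along either diagonal, and its roots with multiplicity
  determine the diagonal up to order.
\<close>

lemma mset_diag_jordan_nf:
  fixes X :: "complex mat"
  assumes "jordan_nf X n_as" "similar_mat X T" "T \<in> carrier_mat n n" "upper_triangular T"
  shows "mset (diag_mat (jordan_matrix n_as)) = mset (diag_mat T)"
proof -
  have proots: "proots (\<Prod>a\<leftarrow>as. [:- a, 1:]) = mset as" for as :: "complex list"
  proof (induction as)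
    case (Cons x as)
    have "(\<Prod>a\<leftarrow>as. [:- a, 1:]) \<noteq> 0" by (auto simp: prod_list_zero_iff)
    then show ?case using Cons by (simp add: proots_mult del: mult_pCons_left)
  qed simp
  have "upper_triangular (jordan_matrix n_as)"
    by (rule upper_triangularI) (auto intro: jordan_matrix_upper_triangular)
  then have "char_poly (jordan_matrix n_as) = (\<Prod>a\<leftarrow>diag_mat (jordan_matrix n_as). [:- a, 1:])"
    by (rule char_poly_upper_triangular[OF jordan_matrix_carrier])
  moreover have "char_poly (jordan_matrix n_as) = char_poly T"
    using assms(1,2) char_poly_similar unfolding jordan_nf_def by metis
  ultimately show ?thesis
    using char_poly_upper_triangular[OF assms(3,4)] proots by metis
qed

text \<open>
  The spectral mapping statement for one matrix. A bound \<open>r\<close> strictly inside the disc of convergence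
  takes the place of the radius of convergence, which may be infinite.
\<close>

lemma jordan_nf_mat_series:
  assumes B: "B \<in> carrier_mat n n" and jnf: "jordan_nf B n_as"
    and r: "r > 0" "\<And>x. x \<in> set (diag_mat (jordan_matrix n_as)) \<Longrightarrow> cmod x < r" "ereal r < conv_radius a"
  shows "\<lbrakk>i < n; j < n\<rbrakk> \<Longrightarrow> summable (\<lambda>k. a k * (B ^\<^sub>m k) $$ (i, j))"
    and "\<exists>n_as'. jordan_nf (mat_series a B) n_as' \<and> mset (diag_mat (jordan_matrix n_as'))
           = image_mset (\<lambda>x. \<Sum>k. a k * x ^ k) (mset (diag_mat (jordan_matrix n_as)))"
proof -
  let ?J = "jordan_matrix n_as"
  obtain P Q where wit: "similar_mat_wit B ?J P Q"
    using jnf by (auto simp: jordan_nf_def similar_mat_def)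
  have J: "?J \<in> carrier_mat n n" using similar_mat_witD2[OF B wit] by simp
  have ut: "upper_triangular ?J" by (rule upper_triangularI) (auto intro: jordan_matrix_upper_triangular)
  have "cmod (?J $$ (i, i)) < r" if "i < n" for i
    using r(2) J that by (auto simp: diag_mat_def)
  note summ = upper_triangular_mat_series_summable[OF J ut r(1) this r(3)]
  show "\<lbrakk>i < n; j < n\<rbrakk> \<Longrightarrow> summable (\<lambda>k. a k * (B ^\<^sub>m k) $$ (i, j))"
    by (rule mat_series_similar(1)[OF wit B summ])
  obtain n_as' where jnf': "jordan_nf (mat_series a B) n_as'"
    using char_poly_factorized[OF mat_series_carrier[OF B]] jordan_nf_exists[OF mat_series_carrier[OF B]] by blast
  have "mset (diag_mat (jordan_matrix n_as')) = mset (diag_mat (mat_series a ?J))"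
    by (rule mset_diag_jordan_nf[OF jnf' mat_series_similar(2)[OF wit B summ]
          mat_series_carrier[OF J] mat_series_upper_triangular(1)[OF J ut]])
  then show "\<exists>n_as'. jordan_nf (mat_series a B) n_as' \<and> mset (diag_mat (jordan_matrix n_as'))
           = image_mset (\<lambda>x. \<Sum>k. a k * x ^ k) (mset (diag_mat ?J))"
    using jnf' by (auto simp: mat_series_upper_triangular(2)[OF J ut])
qed

section \<open>Power series of tensors\<close>

text \<open>
  Slices are finite linear combinations of blocks with coefficients independent of the summation
  index, so blockwise sums give the sum of the tensor series.
\<close>

lemma t_sums_block_idft:
  assumes p: "p \<ge> 1" and B: "\<And>m. m < p \<Longrightarrow> B m \<in> carrier_mat n n"
    and summ: "\<And>m i j. \<lbrakk>m < p; i < n; j < n\<rbrakk> \<Longrightarrow> summable (\<lambda>k. a k * (B m ^\<^sub>m k) $$ (i, j))"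
  shows "t_sums n n p (\<lambda>k. t_smult (a k) (t_pow (block_idft n p B) k)) (block_idft n p (\<lambda>m. mat_series a (B m)))"
  unfolding t_sums_def
proof (intro conjI allI impI block_idft_carrier)
  fix l i j assume lt: "l < p" "i < n" "j < n"
  have "t_smult (a k) (t_pow (block_idft n p B) k) ! l $$ (i, j)
      = (\<Sum>m<p. dft_root p ^ (l * m) * (a k * (B m ^\<^sub>m k) $$ (i, j))) / of_nat p" for k
    using t_pow_block_idft[OF p B, where r = k] lt carrier_tensorD(1)[OF block_idft_carrier[of n p "\<lambda>m. B m ^\<^sub>m k"]]
      carrier_matD[OF carrier_tensorD(2)[OF block_idft_carrier[of n p "\<lambda>m. B m ^\<^sub>m k"] lt(1)]]
    by (simp add: t_smult_def index_block_idft sum_distrib_left mult.left_commute)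
  moreover have "(\<lambda>k. (\<Sum>m<p. dft_root p ^ (l * m) * (a k * (B m ^\<^sub>m k) $$ (i, j))) / of_nat p) sums
      ((\<Sum>m<p. dft_root p ^ (l * m) * mat_series a (B m) $$ (i, j)) / of_nat p)"
    using lt B summ carrier_matD[OF B]
    by (auto intro!: sums_divide sums_sum sums_mult summable_sums simp: mat_series_def)
  ultimately show "(\<lambda>k. t_smult (a k) (t_pow (block_idft n p B) k) ! l $$ (i, j)) sums
      (block_idft n p (\<lambda>m. mat_series a (B m)) ! l $$ (i, j))"
    using lt by (simp add: index_block_idft)
qed

theorem theorem3:
  fixes n p :: nat and A :: tensor and a :: "nat \<Rightarrow> complex" and ev :: "nat \<Rightarrow> nat \<Rightarrow> complex"
  assumes "n \<ge> 1" and "p \<ge> 1"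
    and "A \<in> carrier_tensor n n p"
    and "t_eigenvalues n p A ev"
    and "conv_radius a > ereal (Max {cmod (ev i j) | i j. i < p \<and> j < n})"
  shows "\<exists>S. t_sums n n p (\<lambda>k. t_smult (a k) (t_pow A k)) S \<and>
             (\<forall>i<p. \<forall>j<n. summable (\<lambda>k. a k * ev i j ^ k)) \<and>
             t_eigenvalues n p S (\<lambda>i j. \<Sum>k. a k * ev i j ^ k)"
proof -
  let ?f = "\<lambda>x. \<Sum>k. a k * x ^ k"
  obtain Bs where Bs: "length Bs = p" "set Bs \<subseteq> carrier_mat n n" and A: "A = block_idft n p ((!) Bs)"
    and "\<And>i. i < p \<Longrightarrow> \<exists>n_as. jordan_nf (Bs ! i) n_as \<and>
      mset (map (ev i) [0..<n]) = mset (diag_mat (jordan_matrix n_as))"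
    using assms(4) fourier_blocks_iff[OF assms(2,3)] unfolding t_eigenvalues_def by blast
  then obtain J where J: "\<And>i. i < p \<Longrightarrow> jordan_nf (Bs ! i) (J i)"
      "\<And>i. i < p \<Longrightarrow> mset (map (ev i) [0..<n]) = mset (diag_mat (jordan_matrix (J i)))"
    by metis
  have B: "Bs ! i \<in> carrier_mat n n" if "i < p" for i
    using Bs that by auto
  let ?N = "{cmod (ev i j) | i j. i < p \<and> j < n}"
  have fin: "finite ?N" by (rule finite_image_set2) auto
  obtain r where r: "ereal (Max ?N) < ereal r" "ereal r < conv_radius a"
    using ereal_dense2[OF assms(5)] by auto
  have lt: "cmod (ev i j) < r" if "i < p" "j < n" for i j
    using Max_ge[OF fin, of "cmod (ev i j)"] that r by fastforce
  \<comment> \<open>There is at least one T-eigenvalue, and its modulus is below \<open>r\<close>.\<close>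
  have "r > 0" using lt[of 0 0] assms(1,2) norm_ge_zero[of "ev 0 0"] by linarith
  have "cmod x < r" if "i < p" "x \<in> set (diag_mat (jordan_matrix (J i)))" for i x
  proof -
    have "x \<in> set (map (ev i) [0..<n])" using that J(2) by (metis set_mset_mset)
    then show ?thesis using lt that by auto
  qed
  note series = jordan_nf_mat_series[OF B J(1) \<open>r > 0\<close> this r(2)]
  let ?C = "map (mat_series a) Bs"
  let ?S = "block_idft n p (\<lambda>m. mat_series a (Bs ! m))"
  have "?S = block_idft n p ((!) ?C)"
    using Bs by (auto simp: block_idft_def intro!: cong_mat sum.cong)
  then have "fourier_blocks n p ?S ?C"
    using fourier_blocks_iff[OF assms(2) block_idft_carrier] Bs mat_series_carrier by auto
  moreover have "\<exists>n_as. jordan_nf (?C ! i) n_as \<and>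
      mset (map (\<lambda>j. ?f (ev i j)) [0..<n]) = mset (diag_mat (jordan_matrix n_as))" if i: "i < p" for i
  proof -
    have "mset (map (\<lambda>j. ?f (ev i j)) [0..<n]) = image_mset ?f (mset (map (ev i) [0..<n]))"
      by (simp add: multiset.map_comp comp_def)
    then show ?thesis
      using series(2)[OF i i i] J(2)[OF i] Bs i by auto
  qed
  ultimately have "t_eigenvalues n p ?S (\<lambda>i j. ?f (ev i j))"
    unfolding t_eigenvalues_def by blast
  moreover have "t_sums n n p (\<lambda>k. t_smult (a k) (t_pow A k)) ?S"
    unfolding A using series(1) by (intro t_sums_block_idft[OF assms(2) B]) auto
  moreover have "summable (\<lambda>k. a k * ev i j ^ k)" if "i < p" "j < n" for i j
    using lt[OF that] r(2) by (intro summable_in_conv_radius) (metis ereal_less(3) less_trans less_ereal.simps(1))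
  ultimately show ?thesis by blast
qed

end
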